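(* Let $G$ be a subcubic class two graph. Then $$r(G)=\min\{|R| : R \text{ is a representative conflicting subset of } G\}.$$
   Context: All graphs are finite. A graph is subcubic if every vertex has degree at most 3; a subcubic graph is class two if it has no proper 3-edge-colouring (hence it has maximum degree 3 and a proper 4-edge-colouring). The resistance $r(G)$ of such $G$ is the minimum, over all proper 4-edge-colourings $f$ of $G$ and all colours $i$, of the size $|f^{-1}(i)|$ of the colour class. A conflicting subgraph of $G$ is a subgraph admitting no proper 3-edge-colouring; it is a minimal conflicting subgraph if for every edge $e$ of it, removing $e$ yields a 3-edge-colourable graph. If $M_1,\dots,M_r$ are all the minimal conflicting subgraphs of $G$, a representative conflicting subset of $G$ is a set $R\subseteq E(G)$ of edges such that $R\cap E(M_i)\neq\emptyset$ for each $i$. *)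

theory Defs
  imports Main
begin

text \<open>
  Graphs are finite and loopless, and parallel edges are allowed: an edge is an abstract object
  with a two-element set of end vertices. Simple graphs are the case where \<open>ends\<close> is injective on
  the edges. A loop is excluded because it is adjacent to itself, so that no proper edge colouring
  would exist.
\<close>

record ('v, 'e) multigraph =
  verts :: "'v set"
  edges :: "'e set"
  ends :: "'e \<Rightarrow> 'v set"

definition finite_graph :: "('v, 'e) multigraph \<Rightarrow> bool" where
  "finite_graph G \<longleftrightarrow> finite (verts G) \<and> finite (edges G) \<and>
     (\<forall>e\<in>edges G. ends G e \<subseteq> verts G \<and> card (ends G e) = 2)"

definition degree :: "('v, 'e) multigraph \<Rightarrow> 'v \<Rightarrow> nat" where
  "degree G v = card {e \<in> edges G. v \<in> ends G e}"

definition subcubic :: "('v, 'e) multigraph \<Rightarrow> bool" where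
  "subcubic G \<longleftrightarrow> (\<forall>v\<in>verts G. degree G v \<le> 3)"

definition proper_edge_colouring :: "('v, 'e) multigraph \<Rightarrow> nat \<Rightarrow> ('e \<Rightarrow> nat) \<Rightarrow> bool" where
  "proper_edge_colouring G k f \<longleftrightarrow> f ` edges G \<subseteq> {1..k} \<and>
     (\<forall>d\<in>edges G. \<forall>e\<in>edges G. d \<noteq> e \<and> ends G d \<inter> ends G e \<noteq> {} \<longrightarrow> f d \<noteq> f e)"

definition edge_colourable :: "('v, 'e) multigraph \<Rightarrow> nat \<Rightarrow> bool" where
  "edge_colourable G k \<longleftrightarrow> (\<exists>f. proper_edge_colouring G k f)"

definition class_two :: "('v, 'e) multigraph \<Rightarrow> bool" where
  "class_two G \<longleftrightarrow> \<not> edge_colourable G 3"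

definition colour_class :: "('v, 'e) multigraph \<Rightarrow> ('e \<Rightarrow> nat) \<Rightarrow> nat \<Rightarrow> 'e set" where
  "colour_class G f i = {e \<in> edges G. f e = i}"

text \<open>
  The set below is finite for every finite graph, and it is nonempty exactly when the graph has a
  proper 4-edge-colouring, as every subcubic (loopless) graph does.
\<close>

definition resistance :: "('v, 'e) multigraph \<Rightarrow> nat" where
  "resistance G = Min {card (colour_class G f i) | f i. proper_edge_colouring G 4 f \<and> i \<in> {1..4}}"

definition subgraph :: "('v, 'e) multigraph \<Rightarrow> ('v, 'e) multigraph \<Rightarrow> bool" where
  "subgraph H G \<longleftrightarrow> finite_graph H \<and> verts H \<subseteq> verts G \<and> edges H \<subseteq> edges G \<and>
     (\<forall>e\<in>edges H. ends H e = ends G e)"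

definition delete_edge :: "('v, 'e) multigraph \<Rightarrow> 'e \<Rightarrow> ('v, 'e) multigraph" where
  "delete_edge H e = H\<lparr>edges := edges H - {e}\<rparr>"

definition conflicting_subgraph :: "('v, 'e) multigraph \<Rightarrow> ('v, 'e) multigraph \<Rightarrow> bool" where
  "conflicting_subgraph M G \<longleftrightarrow> subgraph M G \<and> \<not> edge_colourable M 3"

definition minimal_conflicting_subgraph ::
    "('v, 'e) multigraph \<Rightarrow> ('v, 'e) multigraph \<Rightarrow> bool" where
  "minimal_conflicting_subgraph M G \<longleftrightarrow> conflicting_subgraph M G \<and>
     (\<forall>e\<in>edges M. edge_colourable (delete_edge M e) 3)"

definition representative_conflicting_subset :: "('v, 'e) multigraph \<Rightarrow> 'e set \<Rightarrow> bool" where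
  "representative_conflicting_subset G R \<longleftrightarrow> R \<subseteq> edges G \<and>
     (\<forall>M. minimal_conflicting_subgraph M G \<longrightarrow> R \<inter> edges M \<noteq> {})"

end

theory Submission
  imports Defs
begin

text \<open>
  Both sides equal the least number of edges whose removal leaves a 3-edge-colourable graph.
  A set of edges is representative exactly when its removal has this effect, and every colour class
  of a proper 4-edge-colouring is such a set. Conversely, the uncoloured edges of a largest
  3-edge-colourable subgraph form a matching and can therefore be given a fourth colour. Indeed,
  if \<open>uv\<close> and \<open>vw\<close> were both uncoloured, then by maximality \<open>u\<close> and \<open>w\<close> miss the same
  colour \<open>c\<close>, and \<open>v\<close> misses a colour \<open>a \<noteq> c\<close>. The Kempe chain in the colours \<open>a\<close>, \<open>c\<close> through
  \<open>v\<close> is a path with end \<open>v\<close>, so it avoids \<open>u\<close> or \<open>w\<close>; swapping its two colours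
  frees \<open>c\<close> at \<open>v\<close> and one more edge can be coloured.
\<close>

section \<open>Restriction of colourings, missing colours and extension by one edge\<close>

definition misses :: "('v, 'e) multigraph \<Rightarrow> ('e \<Rightarrow> nat) \<Rightarrow> 'v \<Rightarrow> nat \<Rightarrow> bool" where
  "misses G f x c \<longleftrightarrow> (\<forall>d\<in>edges G. x \<in> ends G d \<longrightarrow> f d \<noteq> c)"

lemma edge_colourable_mono:
  assumes "edge_colourable G k" and "edges H \<subseteq> edges G"
    and "\<And>e. e \<in> edges H \<Longrightarrow> ends H e = ends G e"
  shows "edge_colourable H k"
proof -
  obtain f where "proper_edge_colouring G k f"
    using assms(1) unfolding edge_colourable_def by blast
  then have "proper_edge_colouring H k f"
    using assms(2,3) unfolding proper_edge_colouring_def by (simp add: subset_iff image_iff) blast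
  then show ?thesis unfolding edge_colourable_def by blast
qed

lemma other_end:
  assumes "finite_graph G" and "e \<in> edges G" and "v \<in> ends G e"
  obtains u where "ends G e = {u, v}" and "u \<noteq> v"
proof -
  have "card (ends G e) = 2" using assms by (simp add: finite_graph_def)
  then obtain x y where "ends G e = {x, y}" "x \<noteq> y" by (auto simp: card_2_iff)
  then show ?thesis using that assms(3) by (metis insert_commute insert_iff singletonD)
qed

lemma edge_colourable_no_edges: "edges G = {} \<Longrightarrow> edge_colourable G k"
  by (simp add: edge_colourable_def proper_edge_colouring_def)

lemma card_missed_colours:
  assumes "finite (edges G)"
  shows "k - degree G x \<le> card {c \<in> {1..k}. misses G f x c}"
proof -
  let ?D = "{d \<in> edges G. x \<in> ends G d}"
  have "{1..k} - f ` ?D \<subseteq> {c \<in> {1..k}. misses G f x c}"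
    by (auto simp: misses_def)
  then have "card ({1..k} - f ` ?D) \<le> card {c \<in> {1..k}. misses G f x c}"
    by (intro card_mono) auto
  moreover have "card {1..k} - card (f ` ?D) \<le> card ({1..k} - f ` ?D)"
    using assms by (intro diff_card_le_card_Diff) auto
  moreover have "card (f ` ?D) \<le> degree G x"
    unfolding degree_def using assms by (intro card_image_le) auto
  ultimately show ?thesis by simp
qed

lemma edge_colourable_insert:
  assumes f: "proper_edge_colouring (G\<lparr>edges := S\<rparr>) k f" and c: "c \<in> {1..k}"
    and miss: "\<And>x. x \<in> ends G e \<Longrightarrow> misses (G\<lparr>edges := S\<rparr>) f x c"
  shows "edge_colourable (G\<lparr>edges := insert e S\<rparr>) k"
proof (cases "e \<in> S")
  case True
  then show ?thesis using f unfolding edge_colourable_def by (auto simp: insert_absorb)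
next
  case False
  have "proper_edge_colouring (G\<lparr>edges := insert e S\<rparr>) k (f(e := c))"
    unfolding proper_edge_colouring_def
  proof (intro conjI ballI impI)
    show "(f(e := c)) ` edges (G\<lparr>edges := insert e S\<rparr>) \<subseteq> {1..k}"
      using f c unfolding proper_edge_colouring_def by auto
  next
    fix d d'
    assume d: "d \<in> edges (G\<lparr>edges := insert e S\<rparr>)" "d' \<in> edges (G\<lparr>edges := insert e S\<rparr>)"
      "d \<noteq> d' \<and> ends (G\<lparr>edges := insert e S\<rparr>) d \<inter> ends (G\<lparr>edges := insert e S\<rparr>) d' \<noteq> {}"
    have new: "f b \<noteq> c" if "b \<in> S" "ends G b \<inter> ends G e \<noteq> {}" for b
      using miss that unfolding misses_def by auto
    have old: "f b \<noteq> f b'" if "b \<in> S" "b' \<in> S" "b \<noteq> b'" "ends G b \<inter> ends G b' \<noteq> {}" for b b'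
      using f that unfolding proper_edge_colouring_def by auto
    show "(f(e := c)) d \<noteq> (f(e := c)) d'"
      using d new[of d] new[of d'] old[of d d'] by (auto simp: Int_commute)
  qed
  then show ?thesis unfolding edge_colourable_def by blast
qed

section \<open>Kempe changes and the shape of Kempe chains\<close>

text \<open>The set \<open>T\<close> plays the role of the vertex set of the Kempe chain.\<close>

lemma kempe_swap:
  assumes f: "proper_edge_colouring G k f" and ac: "a \<in> {1..k}" "c \<in> {1..k}"
    and closed: "\<And>d. d \<in> edges G \<Longrightarrow> f d \<in> {a, c} \<Longrightarrow> ends G d \<inter> T \<noteq> {} \<Longrightarrow> ends G d \<subseteq> T"
  shows "\<exists>g. proper_edge_colouring G k g \<and>
    (\<forall>x. misses G f x (if x \<in> T then a else c) \<longrightarrow> misses G g x c)"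
proof -
  define g where "g d = (if f d \<in> {a, c} \<and> ends G d \<subseteq> T then (if f d = a then c else a) else f d)"
    for d
  have "g d \<noteq> g e" if "d \<in> edges G" "e \<in> edges G" "d \<noteq> e" "ends G d \<inter> ends G e \<noteq> {}" for d e
  proof -
    have "f d \<noteq> f e" using f that unfolding proper_edge_colouring_def by blast
    \<comment> \<open>By \<open>closed\<close>, two touching edges with colours in
      \<open>{a, c}\<close> are swapped together or both kept.\<close>
    moreover have "ends G d \<subseteq> T \<longleftrightarrow> ends G e \<subseteq> T" if "f d \<in> {a, c}" "f e \<in> {a, c}"
      using closed[of d] closed[of e] that \<open>d \<in> edges G\<close> \<open>e \<in> edges G\<close> \<open>ends G d \<inter> ends G e \<noteq> {}\<close>
      by blast
    ultimately show ?thesis by (auto simp: g_def split: if_splits)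
  qed
  moreover have "g ` edges G \<subseteq> {1..k}"
    using f ac unfolding proper_edge_colouring_def by (auto simp: g_def)
  ultimately have "proper_edge_colouring G k g"
    unfolding proper_edge_colouring_def by blast
  moreover have "misses G g x c" if x: "misses G f x (if x \<in> T then a else c)" for x
    unfolding misses_def
  proof (intro ballI impI)
    fix d assume d: "d \<in> edges G" "x \<in> ends G d"
    have fd: "f d \<noteq> (if x \<in> T then a else c)" using x d unfolding misses_def by blast
    show "g d \<noteq> c"
    proof (cases "x \<in> T")
      case True
      then have "f d = c \<Longrightarrow> ends G d \<subseteq> T" using closed[of d] d by blast
      then show ?thesis using fd True by (auto simp: g_def)
    next
      case False
      then have "\<not> ends G d \<subseteq> T" using d by blast
      then show ?thesis using fd False by (simp add: g_def)
    qed
  qed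
  ultimately show ?thesis by blast
qed

text \<open>
  A largest vertex set containing \<open>v\<close> and spanning at least as many edges as a tree is closed under
  adjacency, since otherwise a neighbour could be added to it. This replaces connected components.
\<close>

lemma closed_set_with_many_edges:
  assumes G: "finite_graph G" and v: "v \<in> verts G"
  obtains T where "v \<in> T" and "T \<subseteq> verts G"
    and "\<And>d. d \<in> edges G \<Longrightarrow> ends G d \<inter> T \<noteq> {} \<Longrightarrow> ends G d \<subseteq> T"
    and "card T \<le> card {d \<in> edges G. ends G d \<subseteq> T} + 1"
proof -
  define P where "P T \<longleftrightarrow> v \<in> T \<and> T \<subseteq> verts G \<and>
    card T \<le> card {d \<in> edges G. ends G d \<subseteq> T} + 1" for T
  have fin: "finite (verts G)" "finite (edges G)" using G by (auto simp: finite_graph_def)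
  have "P {v}" using v by (simp add: P_def)
  moreover have "\<forall>T. P T \<longrightarrow> card T < Suc (card (verts G))"
    using fin by (auto simp: P_def less_Suc_eq_le intro: card_mono)
  ultimately obtain T where T: "P T" and max: "\<And>T'. P T' \<Longrightarrow> card T' \<le> card T"
    using ex_has_greatest_nat[of P "{v}" card "Suc (card (verts G))"] by (metis less_imp_le)
  have finT: "finite T" using T fin by (auto simp: P_def intro: finite_subset)
  have "ends G d \<subseteq> T" if d: "d \<in> edges G" "ends G d \<inter> T \<noteq> {}" for d
  proof (rule ccontr)
    assume out: "\<not> ends G d \<subseteq> T"
    obtain x where x: "x \<in> ends G d" "x \<in> T" using d by blast
    then obtain y where "ends G d = {y, x}" using other_end[OF G d(1)] by blast
    then have xy: "ends G d = {y, x}" "x \<in> T" "y \<notin> T" "y \<in> verts G"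
      using x out G d(1) by (auto simp: finite_graph_def)
    let ?E = "\<lambda>T. {d \<in> edges G. ends G d \<subseteq> T}"
    \<comment> \<open>The edge \<open>d\<close> leads from \<open>T\<close> to the new vertex
      \<open>y\<close>, so the spanned edges increase along with the vertices and the bound in
      \<open>P\<close> survives.\<close>
    have "insert d (?E T) \<subseteq> ?E (insert y T)" using xy d by auto
    then have "card (insert d (?E T)) \<le> card (?E (insert y T))"
      using fin by (intro card_mono) auto
    then have "Suc (card (?E T)) \<le> card (?E (insert y T))"
      using fin out by (subst (asm) card_insert_disjoint) auto
    then have "P (insert y T)" using T xy finT by (auto simp: P_def)
    then show False using max[of "insert y T"] finT xy by simp
  qed
  then show ?thesis using T that unfolding P_def by blast
qed

text \<open>Counting incidences of vertices with edges inside \<open>T\<close> in two ways gives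
  \<open>2 * (card T - 1) \<le> 2 * (card T - card L) + card L\<close>, hence
  \<open>card L \<le> 2\<close>. This expresses that a path has at most two ends without introducing
  walks.\<close>

lemma three_leaves_not_in_closed_set:
  assumes G: "finite_graph G" and deg: "\<And>x. x \<in> verts G \<Longrightarrow> degree G x \<le> 2"
    and T: "T \<subseteq> verts G" "\<And>d. d \<in> edges G \<Longrightarrow> ends G d \<inter> T \<noteq> {} \<Longrightarrow> ends G d \<subseteq> T"
    and card: "card T \<le> card {d \<in> edges G. ends G d \<subseteq> T} + 1"
    and L: "L \<subseteq> T" "\<And>x. x \<in> L \<Longrightarrow> degree G x \<le> 1"
  shows "card L < 3"
proof -
  have fin: "finite (verts G)" "finite (edges G)" using G by (auto simp: finite_graph_def)
  have finT: "finite T" and finL: "finite L" using fin T L by (meson finite_subset)+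
  let ?E = "{d \<in> edges G. ends G d \<subseteq> T}"
  have "2 * card ?E = (\<Sum>x\<in>T. card {d \<in> ?E. x \<in> ends G d})"
  proof (rule sum_multicount[symmetric])
    show "\<forall>d\<in>?E. card {x \<in> T. x \<in> ends G d} = 2"
    proof
      fix d assume d: "d \<in> ?E"
      then have "{x \<in> T. x \<in> ends G d} = ends G d" by auto
      then show "card {x \<in> T. x \<in> ends G d} = 2" using G d by (simp add: finite_graph_def)
    qed
  qed (use finT fin in auto)
  also have "\<dots> \<le> (\<Sum>x\<in>T. degree G x)"
    unfolding degree_def using fin by (intro sum_mono card_mono) auto
  also have "\<dots> = (\<Sum>x\<in>T - L. degree G x) + (\<Sum>x\<in>L. degree G x)"
    using sum.subset_diff[OF L(1) finT] .
  also have "\<dots> \<le> (\<Sum>x\<in>T - L. 2) + (\<Sum>x\<in>L. 1)"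
    using deg T L by (intro add_mono sum_mono) auto
  finally have "2 * card ?E \<le> 2 * (card T - card L) + card L"
    using card_Diff_subset[OF finL L(1)] by simp
  moreover have "card L \<le> card T" using L finT by (intro card_mono)
  ultimately show ?thesis using card by linarith
qed

section \<open>The edges outside a maximal 3-edge-colourable subgraph\<close>

lemma unused_edges_are_matching:
  assumes G: "finite_graph G" "subcubic G"
    and S: "S \<subseteq> edges G" "edge_colourable (G\<lparr>edges := S\<rparr>) 3"
    and max: "\<And>e. e \<in> edges G - S \<Longrightarrow> \<not> edge_colourable (G\<lparr>edges := insert e S\<rparr>) 3"
    and de: "d \<in> edges G - S" "e \<in> edges G - S" "d \<noteq> e"
  shows "ends G d \<inter> ends G e = {}"
proof (rule ccontr)
  assume "ends G d \<inter> ends G e \<noteq> {}"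
  then obtain v where v: "v \<in> ends G d" "v \<in> ends G e" by blast
  obtain u where u: "ends G d = {u, v}" "u \<noteq> v"
    using other_end[OF G(1)] v de by blast
  obtain w where w: "ends G e = {w, v}" "w \<noteq> v"
    using other_end[OF G(1)] v de by blast
  have V: "u \<in> verts G" "v \<in> verts G" "w \<in> verts G"
    using G(1) u w de by (auto simp: finite_graph_def)
  have finE: "finite (edges G)" using G(1) by (simp add: finite_graph_def)
  have finS: "finite S" using S(1) finE by (rule finite_subset)
  define H where "H = G\<lparr>edges := S\<rparr>"
  have H: "edges H = S" "ends H = ends G" "verts H = verts G" by (simp_all add: H_def)
  obtain f where f: "proper_edge_colouring H 3 f"
    using S(2) unfolding edge_colourable_def H_def by blast
  \<comment> \<open>Maximality is recorded for every colouring \<open>g\<close> of \<open>H\<close>,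
    because it is applied first to \<open>f\<close> and finally to the swapped colouring.\<close>
  have uncol: "\<not> (\<forall>x\<in>ends G b. misses H g x c)"
    if "proper_edge_colouring H 3 g" "b \<in> {d, e}" "c \<in> {1..3}" for g b c
    using edge_colourable_insert[where G = G and S = S and k = 3 and f = g and c = c and e = b] max[of b] that de unfolding H_def by blast
  have deg: "degree H x + card B \<le> 3"
    if "x \<in> verts G" "B \<subseteq> {d, e}" "\<forall>b\<in>B. x \<in> ends G b" for x B
  proof -
    have "finite B" using that(2) by (rule finite_subset) simp
    then have "degree H x + card B = card ({b \<in> S. x \<in> ends G b} \<union> B)"
      unfolding degree_def H using finS that(2) de by (subst card_Un_disjoint) auto
    also have "\<dots> \<le> degree G x"
      unfolding degree_def using finE that S(1) de by (intro card_mono) auto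
    also have "\<dots> \<le> 3" using G(2) that(1) by (simp add: subcubic_def)
    finally show ?thesis .
  qed
  have missed: "n \<le> card {c \<in> {1..3}. misses H f x c}" if "degree H x + n \<le> 3" for x n
    using card_missed_colours[of H 3 x f] finS H(1) that by simp
  have two: "2 \<le> card {c \<in> {1..3}. misses H f v c}"
    using missed deg[of v "{d, e}"] V v de(3) by simp
  have one: "\<exists>c\<in>{1..3}. misses H f x c" if "b \<in> {d, e}" "x \<in> ends G b" "x \<in> verts G" for x b
  proof -
    have "1 \<le> card {c \<in> {1..3}. misses H f x c}"
      using missed deg[of x "{b}"] that by simp
    then have "{c \<in> {1..3}. misses H f x c} \<noteq> {}" by (metis card.empty not_one_le_zero)
    then show ?thesis by blast
  qed
  obtain c where c: "c \<in> {1..3}" "misses H f u c" using one[of d u] u V by auto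
  \<comment> \<open>A colour missing at both \<open>u\<close> and \<open>v\<close> could be given to
    \<open>d\<close>. So \<open>c\<close> occurs at \<open>v\<close>, and the two colours that
    \<open>v\<close> must miss are exactly the others.\<close>
  have v_hits: "\<not> misses H f v c" using uncol[OF f, of d c] c u by auto
  then have "{b \<in> {1..3}. misses H f v b} \<subseteq> {1..3} - {c}" by auto
  moreover have "card ({1..3} - {c}) = 2" using c by simp
  ultimately have v_misses: "{b \<in> {1..3}. misses H f v b} = {1..3} - {c}"
    using two by (intro card_seteq) auto
  have only_c: "b = c" if "b \<in> {1..3}" "misses H f x b" "x \<in> {u, w}" for b x
  proof (rule ccontr)
    assume "b \<noteq> c"
    then have "misses H f v b" using v_misses that(1) by blast
    then show False using uncol[OF f, of d b] uncol[OF f, of e b] that u w by auto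
  qed
  obtain c' where "c' \<in> {1..3}" "misses H f w c'" using one[of e w] w V by auto
  then have wc: "misses H f w c" using only_c[of c' w] by auto
  \<comment> \<open>If \<open>d\<close> and \<open>e\<close> were parallel, \<open>u\<close> would
    miss two colours, contrary to \<open>only_c\<close>.\<close>
  have "u \<noteq> w"
  proof
    assume "u = w"
    then have "2 \<le> card {b \<in> {1..3}. misses H f u b}"
      using missed deg[of u "{d, e}"] V u w de(3) by simp
    moreover have "card {b \<in> {1..3}. misses H f u b} \<le> card {c}"
      using only_c by (intro card_mono) auto
    ultimately show False by simp
  qed
  obtain a where a: "a \<in> {1..3}" "a \<noteq> c" "misses H f v a"
  proof -
    have "{b \<in> {1..3}. misses H f v b} \<noteq> {}"
      using two by (metis card.empty not_numeral_le_zero)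
    then show ?thesis using v_hits that by blast
  qed
  \<comment> \<open>The components of \<open>K\<close> are the Kempe chains in the colours
    \<open>a\<close> and \<open>c\<close>. Each of \<open>u\<close>, \<open>v\<close>,
    \<open>w\<close> misses one of these colours, so it has degree at most 1 in
    \<open>K\<close>.\<close>
  define K where "K = G\<lparr>edges := {b \<in> S. f b \<in> {a, c}}\<rparr>"
  have K: "edges K = {b \<in> S. f b \<in> {a, c}}" "ends K = ends G" "verts K = verts G"
    by (simp_all add: K_def)
  have fgK: "finite_graph K"
    using G(1) S(1) finS unfolding finite_graph_def K by auto
  \<comment> \<open>Edges of \<open>K\<close> at \<open>x\<close> have distinct colours. Taking
    \<open>C\<close> to be everything gives the bound 2; taking the complement of a missed colour
    gives 1.\<close>
  have degK: "degree K x \<le> card (C \<inter> {a, c})" if "\<And>b. b \<in> S \<Longrightarrow> x \<in> ends G b \<Longrightarrow> f b \<in> C" for x C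
  proof -
    have "inj_on f {b \<in> edges K. x \<in> ends K b}"
      using f unfolding proper_edge_colouring_def H K inj_on_def by blast
    moreover have "f ` {b \<in> edges K. x \<in> ends K b} \<subseteq> C \<inter> {a, c}" using that K by auto
    ultimately show ?thesis unfolding degree_def by (intro card_inj_on_le) auto
  qed
  have degK2: "degree K x \<le> 2" for x
    using degK[of x UNIV] a(2) by simp
  have leaf: "degree K x \<le> 1" if x: "x \<in> {u, v, w}" for x
  proof -
    consider "misses H f x a" | "misses H f x c" using x a c wc by blast
    then show ?thesis
    proof cases
      case 1
      then have "degree K x \<le> card (- {a} \<inter> {a, c})" by (intro degK) (auto simp: misses_def H)
      also have "- {a} \<inter> {a, c} = {c}" using a(2) by auto
      finally show ?thesis by simp
    next
      case 2
      then have "degree K x \<le> card (- {c} \<inter> {a, c})" by (intro degK) (auto simp: misses_def H)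
      also have "- {c} \<inter> {a, c} = {a}" using a(2) by auto
      finally show ?thesis by simp
    qed
  qed
  obtain T where T: "v \<in> T" "T \<subseteq> verts K"
    "\<And>b. b \<in> edges K \<Longrightarrow> ends K b \<inter> T \<noteq> {} \<Longrightarrow> ends K b \<subseteq> T"
    "card T \<le> card {b \<in> edges K. ends K b \<subseteq> T} + 1"
    by (rule closed_set_with_many_edges[OF fgK, of v]) (use V K in auto)
  have "card {u, v, w} = 3" using \<open>u \<noteq> w\<close> u w by simp
  then have "\<not> {u, v, w} \<subseteq> T"
    using three_leaves_not_in_closed_set[OF fgK degK2 T(2-4), of "{u, v, w}"] leaf by auto
  have closed: "ends H b \<subseteq> T" if "b \<in> edges H" "f b \<in> {a, c}" "ends H b \<inter> T \<noteq> {}" for b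
    using T(3)[of b] that by (simp add: H K)
  obtain g where g: "proper_edge_colouring H 3 g"
    "\<And>x. misses H f x (if x \<in> T then a else c) \<Longrightarrow> misses H g x c"
    using kempe_swap[OF f a(1) c(1) closed] by blast
  \<comment> \<open>Inside \<open>T\<close> the swap turns the missing \<open>a\<close> at
    \<open>v\<close> into a missing \<open>c\<close>. Whichever of \<open>u\<close> and
    \<open>w\<close> lies outside \<open>T\<close> still misses \<open>c\<close>, so
    \<open>d\<close> or \<open>e\<close> could be coloured.\<close>
  have "misses H g v c" using g(2)[of v] T(1) a by simp
  moreover have "misses H g u c \<or> misses H g w c"
    using \<open>\<not> {u, v, w} \<subseteq> T\<close> T(1) g(2)[of u] g(2)[of w] c wc by auto
  ultimately show False using uncol[OF g(1), of d c] uncol[OF g(1), of e c] c u w by auto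
qed

section \<open>Edge deletions and colour classes of 4-edge-colourings\<close>

text \<open>A largest 3-edge-colourable edge set is at least as large as \<open>edges G - R\<close>.
  Its complement is a matching, so colour 4 can serve for all of it.\<close>

lemma four_colouring_with_small_class:
  assumes G: "finite_graph G" "subcubic G"
    and R: "R \<subseteq> edges G" "edge_colourable (G\<lparr>edges := edges G - R\<rparr>) 3"
  obtains f where "proper_edge_colouring G 4 f" and "card (colour_class G f 4) \<le> card R"
proof -
  define P where "P S \<longleftrightarrow> S \<subseteq> edges G \<and> edge_colourable (G\<lparr>edges := S\<rparr>) 3" for S
  have finE: "finite (edges G)" using G(1) by (simp add: finite_graph_def)
  have P0: "P (edges G - R)" using R by (auto simp: P_def)
  have "\<forall>S. P S \<longrightarrow> card S < Suc (card (edges G))"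
    using finE by (auto simp: P_def less_Suc_eq_le intro: card_mono)
  then obtain S where S: "P S" and max: "\<And>S'. P S' \<Longrightarrow> card S' \<le> card S"
    using P0 ex_has_greatest_nat[of P "edges G - R" card "Suc (card (edges G))"]
    by (metis less_imp_le)
  have finS: "finite S" using S finE by (auto simp: P_def intro: finite_subset)
  have "\<not> edge_colourable (G\<lparr>edges := insert e S\<rparr>) 3" if "e \<in> edges G - S" for e
    using max[of "insert e S"] S that finS by (auto simp: P_def)
  then have matching: "ends G d \<inter> ends G e = {}"
    if "d \<in> edges G - S" "e \<in> edges G - S" "d \<noteq> e" for d e
    using unused_edges_are_matching[OF G, of S d e] S that unfolding P_def by blast
  obtain f where f: "proper_edge_colouring (G\<lparr>edges := S\<rparr>) 3 f"
    using S unfolding P_def edge_colourable_def by blast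
  define g where "g e = (if e \<in> S then f e else 4)" for e
  have f3: "f e \<in> {1..3}" if "e \<in> S" for e
    using f that unfolding proper_edge_colouring_def by auto
  have "g d \<noteq> g e" if "d \<in> edges G" "e \<in> edges G" "d \<noteq> e" "ends G d \<inter> ends G e \<noteq> {}" for d e
  proof (cases "d \<in> S \<and> e \<in> S")
    case True
    then show ?thesis using f that unfolding proper_edge_colouring_def g_def by auto
  next
    case False
    then show ?thesis using matching[of d e] that f3[of d] f3[of e] by (auto simp: g_def)
  qed
  moreover have "g ` edges G \<subseteq> {1..4}" using f3 by (fastforce simp: g_def)
  ultimately have "proper_edge_colouring G 4 g" unfolding proper_edge_colouring_def by blast
  moreover have "card (colour_class G g 4) \<le> card R"
  proof -
    have "colour_class G g 4 = edges G - S" using f3 by (fastforce simp: colour_class_def g_def)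
    then have "card (colour_class G g 4) = card (edges G) - card S"
      using S finS by (simp add: P_def card_Diff_subset)
    moreover have "card (edges G) - card R \<le> card S"
      using max[OF P0] R finE by (simp add: card_Diff_subset finite_subset)
    ultimately show ?thesis by linarith
  qed
  ultimately show ?thesis using that by blast
qed

lemma edge_colourable_without_colour_class:
  assumes f: "proper_edge_colouring G (Suc k) f" and i: "i \<in> {1..Suc k}"
  shows "edge_colourable (G\<lparr>edges := edges G - colour_class G f i\<rparr>) k"
proof -
  \<comment> \<open>Colours above \<open>i\<close> move down by one to restore the palette
    \<open>{1..k}\<close>. Only \<open>i\<close> and \<open>i - 1\<close> would collide, and
    \<open>i\<close> no longer occurs.\<close>
  define h where "h j = (if j < i then j else j - 1)" for j :: nat
  have h: "h j \<in> {1..k}" if "j \<in> {1..Suc k} - {i}" for j using that i by (auto simp: h_def)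
  have inj: "inj_on h (- {i})" by (auto simp: inj_on_def h_def split: if_splits)
  have "proper_edge_colouring (G\<lparr>edges := edges G - colour_class G f i\<rparr>) k (h \<circ> f)"
    unfolding proper_edge_colouring_def
  proof (intro conjI ballI impI)
    show "(h \<circ> f) ` edges (G\<lparr>edges := edges G - colour_class G f i\<rparr>) \<subseteq> {1..k}"
    proof
      fix j assume "j \<in> (h \<circ> f) ` edges (G\<lparr>edges := edges G - colour_class G f i\<rparr>)"
      then obtain e where "e \<in> edges G" "f e \<noteq> i" "j = h (f e)"
        by (auto simp: colour_class_def)
      then show "j \<in> {1..k}" using h f unfolding proper_edge_colouring_def by blast
    qed
  next
    fix d e
    assume "d \<in> edges (G\<lparr>edges := edges G - colour_class G f i\<rparr>)"
      "e \<in> edges (G\<lparr>edges := edges G - colour_class G f i\<rparr>)"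
      "d \<noteq> e \<and> ends (G\<lparr>edges := edges G - colour_class G f i\<rparr>) d \<inter>
        ends (G\<lparr>edges := edges G - colour_class G f i\<rparr>) e \<noteq> {}"
    then have "f d \<noteq> f e" "f d \<noteq> i" "f e \<noteq> i"
      using f unfolding proper_edge_colouring_def colour_class_def by auto
    then show "(h \<circ> f) d \<noteq> (h \<circ> f) e" using inj by (auto simp: inj_on_def)
  qed
  then show ?thesis unfolding edge_colourable_def by blast
qed

section \<open>Representative subsets and the equality of the two minima\<close>

text \<open>If a conflict survives the deletion of \<open>R\<close>, shrinking it yields a minimal
  conflicting subgraph that avoids \<open>R\<close>. Conversely, a subgraph avoiding
  \<open>R\<close> inherits the 3-edge-colouring.\<close>

lemma representative_iff_edge_colourable:
  assumes G: "finite_graph G"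
  shows "representative_conflicting_subset G R \<longleftrightarrow>
    R \<subseteq> edges G \<and> edge_colourable (G\<lparr>edges := edges G - R\<rparr>) 3"
proof (intro iffI conjI)
  assume R: "representative_conflicting_subset G R"
  then show "R \<subseteq> edges G" by (simp add: representative_conflicting_subset_def)
  show "edge_colourable (G\<lparr>edges := edges G - R\<rparr>) 3"
  proof (rule ccontr)
    assume bad: "\<not> edge_colourable (G\<lparr>edges := edges G - R\<rparr>) 3"
    \<comment> \<open>Only edge sets are minimised and all vertices of \<open>G\<close> are kept:
      minimality of a conflicting subgraph concerns edge removal alone.\<close>
    define C where "C = {S. S \<subseteq> edges G - R \<and> \<not> edge_colourable (G\<lparr>edges := S\<rparr>) 3}"
    have finE: "finite (edges G)" using G by (simp add: finite_graph_def)
    have "finite C"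
      using finE by (intro finite_subset[of C "Pow (edges G)"]) (auto simp: C_def)
    moreover have "C \<noteq> {}" using bad by (auto simp: C_def)
    ultimately obtain S where "S \<in> C" and min: "\<And>S'. S' \<in> C \<Longrightarrow> S' \<subseteq> S \<Longrightarrow> S = S'"
      using finite_has_minimal[of C] by blast
    then have S: "S \<subseteq> edges G - R" "\<not> edge_colourable (G\<lparr>edges := S\<rparr>) 3"
      by (simp_all add: C_def)
    have finS: "finite S" using finite_subset[of S "edges G"] S finE by blast
    have "edge_colourable (G\<lparr>edges := S - {e}\<rparr>) 3" if "e \<in> S" for e
      using min[of "S - {e}"] S(1) that by (auto simp: C_def)
    then have "minimal_conflicting_subgraph (G\<lparr>edges := S\<rparr>) G"
      unfolding minimal_conflicting_subgraph_def conflicting_subgraph_def subgraph_def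
        delete_edge_def finite_graph_def
      using S G finS by (auto simp: finite_graph_def)
    then have "R \<inter> S \<noteq> {}" using R unfolding representative_conflicting_subset_def by force
    then show False using S by blast
  qed
next
  assume R: "R \<subseteq> edges G \<and> edge_colourable (G\<lparr>edges := edges G - R\<rparr>) 3"
  have "R \<inter> edges M \<noteq> {}" if "minimal_conflicting_subgraph M G" for M
  proof
    assume disj: "R \<inter> edges M = {}"
    have M: "edges M \<subseteq> edges G" "\<And>e. e \<in> edges M \<Longrightarrow> ends M e = ends G e"
      "\<not> edge_colourable M 3"
      using that unfolding minimal_conflicting_subgraph_def conflicting_subgraph_def subgraph_def
      by auto
    have "edge_colourable M 3"
    proof (rule edge_colourable_mono)
      show "edge_colourable (G\<lparr>edges := edges G - R\<rparr>) 3" using R by blast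
      show "edges M \<subseteq> edges (G\<lparr>edges := edges G - R\<rparr>)" using M(1) disj by auto
      show "ends M e = ends (G\<lparr>edges := edges G - R\<rparr>) e" if "e \<in> edges M" for e
        using M(2)[OF that] by simp
    qed
    then show False using M(3) by blast
  qed
  then show "representative_conflicting_subset G R"
    using R unfolding representative_conflicting_subset_def by blast
qed

theorem theorem2p6:
  fixes G :: "('v, 'e) multigraph"
  assumes "finite_graph G" and "subcubic G" and "class_two G"
  shows "resistance G = Min {card R | R. representative_conflicting_subset G R}"
proof -
  let ?A = "{card (colour_class G f i) | f i. proper_edge_colouring G 4 f \<and> i \<in> {1..4}}"
  let ?B = "{card R | R. representative_conflicting_subset G R}"
  have finE: "finite (edges G)" using assms(1) by (simp add: finite_graph_def)
  have finB: "finite ?B"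
    by (rule finite_subset[of _ "card ` Pow (edges G)"])
      (use finE in \<open>auto simp: representative_conflicting_subset_def\<close>)
  have sub: "?A \<subseteq> ?B"
  proof
    fix n assume "n \<in> ?A"
    then obtain f i where fi: "n = card (colour_class G f i)" "proper_edge_colouring G 4 f"
      "i \<in> {1..4}" by blast
    have "colour_class G f i \<subseteq> edges G" by (auto simp: colour_class_def)
    then have "representative_conflicting_subset G (colour_class G f i)"
      using edge_colourable_without_colour_class[of G 3 f i] fi(2,3)
      by (simp add: representative_iff_edge_colourable[OF assms(1)])
    then show "n \<in> ?B" using fi(1) by blast
  qed
  have below: "\<exists>m\<in>?A. m \<le> n" if "n \<in> ?B" for n
  proof -
    obtain R where R: "n = card R" "representative_conflicting_subset G R" using \<open>n \<in> ?B\<close> by blast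
    then obtain f where "proper_edge_colouring G 4 f" "card (colour_class G f 4) \<le> n"
      using four_colouring_with_small_class[OF assms(1,2), of R]
        representative_iff_edge_colourable[OF assms(1)] by metis
    moreover have "(4::nat) \<in> {1..4}" by simp
    ultimately show ?thesis by blast
  qed
  have finA: "finite ?A" using sub finB by (rule finite_subset)
  \<comment> \<open>\<open>Min\<close> is meaningful only on nonempty sets. Deleting all edges makes
    \<open>?B\<close> nonempty, and \<open>below\<close> then provides a 4-edge-colouring, so
    \<open>?A\<close> is nonempty too.\<close>
  have "representative_conflicting_subset G (edges G)"
    using representative_iff_edge_colourable[OF assms(1)] by (simp add: edge_colourable_no_edges)
  then have "?B \<noteq> {}" by blast
  moreover from this have "?A \<noteq> {}" using below[OF Min_in[OF finB]] by blast
  ultimately have "Min ?A \<le> Min ?B"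
    using below[OF Min_in[OF finB]] Min_le[OF finA] by (meson le_trans)
  moreover have "Min ?B \<le> Min ?A"
    using sub \<open>?A \<noteq> {}\<close> finB by (rule Min_antimono)
  ultimately show ?thesis unfolding resistance_def by (rule antisym)
qed

end
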